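(* For all $x\in(0,\pi/2]$, $$\frac{4\sqrt2-2}{7\pi}\left(x+\sin x+8\sin\frac x2\right)<\mathrm{Si}(x)<\frac16\left(x+\sin x+8\sin\frac x2\right).$$
   Context: $\mathrm{Si}(x)=\displaystyle\int_0^x\frac{\sin t}{t}\,dt$ is the sine integral. *)

theory Defs
  imports "HOL-Probability.Sinc_Integral"
begin

end

theory Submission
  imports Defs
begin

text \<open>
  Put $G(x) = x + \sin x + 8 \sin (x/2)$ and $u = x/2$. Then $G'(x) = 2 \cos u\,(2 + \cos u)$,
  while the derivative of the sine integral is $\sin x / x = \cos u \cdot \sin u / u$, so that the
  quotient of the two derivatives is $\rho(u) / 2$ with $\rho(u) = \sin u / (u (2 + \cos u))$.
  All three functions vanish at $x = 0$, and $G' > 0$ on $(0, \pi/2)$ because $\cos u > 0$ there;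
  hence it suffices to enclose $\rho$ on $(0, \pi/4)$.

  The upper bound $\rho(u) < 1/3$ is the Cusa--Huygens inequality (\<open>cusa_huygens\<close>).
  For the lower bound, $\rho$ is strictly decreasing (\<open>cusa_quotient_strict_antimono\<close>), so it
  exceeds $\rho(\pi/4)$; and $\rho(\pi/4)/2$ is precisely the constant $(4\sqrt 2 - 2)/(7\pi)$
  (\<open>cusa_quotient_pi_quarter\<close>).
\<close>

lemma sin_less_self:
  fixes u :: real
  assumes "0 < u" "u \<le> pi"
  shows "sin u < u"
proof -
  have "0 - sin 0 < u - sin u"
  proof (rule DERIV_pos_imp_increasing_open [OF assms(1)])
    fix t assume "0 < t" "t < u"
    then have "((\<lambda>t. t - sin t) has_real_derivative 1 - cos t) (at t)" "0 < 1 - cos t"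
      using assms cos_monotone_0_pi [of 0 t] by (auto intro!: derivative_eq_intros)
    then show "\<exists>y. ((\<lambda>t. t - sin t) has_real_derivative y) (at t) \<and> 0 < y"
      by blast
  qed (intro continuous_intros)
  then show ?thesis by simp
qed

lemma mult_cos_less_sin:
  fixes v :: real
  assumes "0 < v" "v \<le> pi"
  shows "v * cos v < sin v"
proof -
  have "sin 0 - 0 * cos 0 < sin v - v * cos v"
  proof (rule DERIV_pos_imp_increasing_open [OF assms(1)])
    fix t assume "0 < t" "t < v"
    then have "((\<lambda>t. sin t - t * cos t) has_real_derivative t * sin t) (at t)" "0 < t * sin t"
      using assms sin_gt_zero [of t] by (auto intro!: derivative_eq_intros simp: algebra_simps)
    then show "\<exists>y. ((\<lambda>t. sin t - t * cos t) has_real_derivative y) (at t) \<and> 0 < y"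
      by blast
  qed (intro continuous_intros)
  then show ?thesis by simp
qed

text \<open>
  The derivative of $u(2 + \cos u) - 3 \sin u$ is $2 - 2\cos u - u \sin u$, which by the half-angle
  formulas equals $4 \sin v\,(\sin v - v \cos v)$ with $v = u/2$.
\<close>
lemma cusa_huygens:
  fixes u :: real
  assumes "0 < u" "u \<le> pi"
  shows "3 * sin u < u * (2 + cos u)"
proof -
  have "0 * (2 + cos 0) - 3 * sin 0 < u * (2 + cos u) - 3 * sin u"
  proof (rule DERIV_pos_imp_increasing_open [OF assms(1)])
    fix t assume t: "0 < t" "t < u"
    define v where "v = t / 2"
    have v: "0 < v" "v < pi" and tv: "t = 2 * v"
      using t assms by (auto simp: v_def)
    have "0 < 4 * sin v * (sin v - v * cos v)"
      using mult_cos_less_sin [of v] sin_gt_zero [of v] v by auto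
    also have "\<dots> = 2 - 2 * cos t - t * sin t"
      unfolding tv cos_double_sin sin_double by (simp add: algebra_simps power2_eq_square)
    finally have "0 < 2 - 2 * cos t - t * sin t" .
    moreover have "((\<lambda>t. t * (2 + cos t) - 3 * sin t) has_real_derivative
        2 - 2 * cos t - t * sin t) (at t)"
      by (auto intro!: derivative_eq_intros)
    ultimately show "\<exists>y. ((\<lambda>t. t * (2 + cos t) - 3 * sin t) has_real_derivative y) (at t) \<and> 0 < y"
      by blast
  qed (intro continuous_intros)
  then show ?thesis by simp
qed

text \<open>
  Left side minus right side is the numerator of the derivative of
  $\sin u / (u (2 + \cos u))$. It vanishes at $0$ and has derivative $2 \sin u\,(\sin u - u)$.
\<close>
lemma cusa_quotient_deriv_numerator_neg:
  fixes u :: real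
  assumes "0 < u" "u \<le> pi"
  shows "u * (1 + 2 * cos u) < sin u * (2 + cos u)"
proof -
  have "sin 0 * (2 + cos 0) - 0 * (1 + 2 * cos 0) < sin u * (2 + cos u) - u * (1 + 2 * cos u)"
  proof (rule DERIV_pos_imp_increasing_open [OF assms(1)])
    fix t assume t: "0 < t" "t < u"
    have "cos t * cos t = 1 - sin t * sin t"
      using sin_cos_squared_add [of t] by (simp add: power2_eq_square)
    then have "((\<lambda>t. sin t * (2 + cos t) - t * (1 + 2 * cos t)) has_real_derivative
        2 * sin t * (t - sin t)) (at t)"
      by (auto intro!: derivative_eq_intros simp: algebra_simps)
    moreover have "0 < 2 * sin t * (t - sin t)"
      using t assms sin_gt_zero [of t] sin_less_self [of t] by auto
    ultimately show "\<exists>y. ((\<lambda>t. sin t * (2 + cos t) - t * (1 + 2 * cos t)) has_real_derivative y)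
        (at t) \<and> 0 < y"
      by blast
  qed (intro continuous_intros)
  then show ?thesis by simp
qed

lemma two_plus_cos_pos: "0 < 2 + cos (u :: real)"
  using cos_ge_minus_one [of u] by linarith

lemma cusa_quotient_strict_antimono:
  fixes u w :: real
  assumes "0 < u" "u < w" "w \<le> pi"
  shows "sin w / (w * (2 + cos w)) < sin u / (u * (2 + cos u))"
proof (rule DERIV_neg_imp_decreasing_open [OF assms(2)])
  fix t assume t: "u < t" "t < w"
  then have nz: "0 < t * (2 + cos t)"
    using assms two_plus_cos_pos [of t] by simp
  have sq: "cos t * cos t = 1 - sin t * sin t"
    using sin_cos_squared_add [of t] by (simp add: power2_eq_square)
  let ?N = "t * (1 + 2 * cos t) - sin t * (2 + cos t)"
  have "cos t * (t * (2 + cos t)) - sin t * (1 * (2 + cos t) + (0 - sin t) * t) = ?N"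
    using sq by algebra
  moreover have "((\<lambda>t. sin t / (t * (2 + cos t))) has_real_derivative
      (cos t * (t * (2 + cos t)) - sin t * (1 * (2 + cos t) + (0 - sin t) * t))
        / (t * (2 + cos t) * (t * (2 + cos t)))) (at t)"
    using nz by (auto intro!: derivative_eq_intros)
  moreover have "?N / (t * (2 + cos t) * (t * (2 + cos t))) < 0"
    using cusa_quotient_deriv_numerator_neg [of t] t assms nz by (intro divide_neg_pos) auto
  ultimately show "\<exists>y. ((\<lambda>t. sin t / (t * (2 + cos t))) has_real_derivative y) (at t) \<and> y < 0"
    by metis
next
  have "t * (2 + cos t) \<noteq> 0" if "t \<in> {u..w}" for t
    using that assms two_plus_cos_pos [of t] by auto
  then show "continuous_on {u..w} (\<lambda>t. sin t / (t * (2 + cos t)))"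
    by (intro continuous_intros) auto
qed

lemma cusa_quotient_pi_quarter:
  "sin (pi / 4) / (pi / 4 * (2 + cos (pi / 4))) = 2 * ((4 * sqrt 2 - 2) / (7 * pi))"
proof -
  define r where "r = sqrt 2"
  have r: "r * r = 2" and pos: "pi / 4 * (2 + r / 2) \<noteq> 0"
    using two_plus_cos_pos [of "pi / 4"] by (auto simp: r_def cos_45)
  have "r / 2 * (7 * pi) = pi / 2 * (7 * r + 2 * (r * r) - 4)"
    unfolding r by simp
  also have "\<dots> = 2 * (4 * r - 2) * (pi / 4 * (2 + r / 2))"
    by (simp add: algebra_simps)
  finally have "r / 2 / (pi / 4 * (2 + r / 2)) = 2 * (4 * r - 2) / (7 * pi)"
    using pos by (subst frac_eq_eq) auto
  then show ?thesis
    by (simp add: sin_45 cos_45 r_def)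
qed

text \<open>
  Since $1 + \cos t = 2\cos^2 (t/2)$ and $\sin t = 2 \sin (t/2) \cos (t/2)$, a factor
  $\cos (t/2)$ splits off from both derivatives, and the sign of the difference is governed by the
  quotient $\sin u / (u (2 + \cos u))$ at $u = t/2$ alone.
\<close>
lemma has_real_derivative_diff_Si:
  fixes a t :: real
  assumes "t \<noteq> 0"
  shows "((\<lambda>t. a * (t + sin t + 8 * sin (t / 2)) - Si t) has_real_derivative
    cos (t / 2) * (2 + cos (t / 2)) * (2 * a - sin (t / 2) / (t / 2 * (2 + cos (t / 2))))) (at t)"
proof -
  define u where "u = t / 2"
  have t: "t = 2 * u" and u: "u \<noteq> 0"
    using assms by (auto simp: u_def)
  have "((\<lambda>t. a * (t + sin t + 8 * sin (t / 2)) - Si t) has_real_derivative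
      a * (1 + cos t + 8 * (cos (t / 2) / 2)) - sin t / t) (at t)"
    using assms DERIV_Si [of t] by (auto intro!: derivative_eq_intros)
  moreover have "cos u * (2 + cos u) * (sin u / (u * (2 + cos u))) = sin t / t"
    using u two_plus_cos_pos [of u] unfolding t sin_double by simp
  then have "a * (1 + cos t + 8 * (cos (t / 2) / 2)) - sin t / t
      = cos u * (2 + cos u) * (2 * a - sin u / (u * (2 + cos u)))"
    unfolding right_diff_distrib t cos_double_cos by (simp add: algebra_simps power2_eq_square)
  ultimately show ?thesis
    by (simp add: u_def)
qed

theorem proposition6:
  fixes x :: real
  assumes "x \<in> {0<..pi / 2}"
  shows "(4 * sqrt 2 - 2) / (7 * pi) * (x + sin x + 8 * sin (x / 2)) < Si x
    \<and> Si x < 1 / 6 * (x + sin x + 8 * sin (x / 2))"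
proof
  let ?D = "\<lambda>a t. a * (t + sin t + 8 * sin (t / 2)) - Si t"
  let ?D' = "\<lambda>a t. cos (t / 2) * (2 + cos (t / 2))
    * (2 * a - sin (t / 2) / (t / 2 * (2 + cos (t / 2))))"
  have x: "0 < x" "x \<le> pi / 2"
    using assms by auto
  have at_0: "?D a 0 = 0" for a
    by (simp add: Si_def flip: zero_ereal_def)
  have cont: "continuous_on {0..x} (?D a)" for a
    by (intro continuous_intros continuous_at_imp_continuous_on ballI isCont_Si) auto
  have factor: "0 < cos (t / 2) * (2 + cos (t / 2))" if "0 < t" "t < x" for t
    using that x two_plus_cos_pos [of "t / 2"] by (intro mult_pos_pos cos_gt_zero) auto

  let ?k = "(4 * sqrt 2 - 2) / (7 * pi)"
  have "?D ?k x < ?D ?k 0"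
  proof (rule DERIV_neg_imp_decreasing_open [OF x(1) _ cont])
    fix t assume t: "0 < t" "t < x"
    have "2 * ?k < sin (t / 2) / (t / 2 * (2 + cos (t / 2)))"
      using cusa_quotient_strict_antimono [of "t / 2" "pi / 4"] t x
      unfolding cusa_quotient_pi_quarter by auto
    then have "?D' ?k t < 0"
      by (intro mult_pos_neg [OF factor [OF t]]) auto
    then show "\<exists>y. (?D ?k has_real_derivative y) (at t) \<and> y < 0"
      using has_real_derivative_diff_Si [of t ?k] t by blast
  qed
  then show "?k * (x + sin x + 8 * sin (x / 2)) < Si x"
    unfolding at_0 by linarith

  have "?D (1 / 6) 0 < ?D (1 / 6) x"
  proof (rule DERIV_pos_imp_increasing_open [OF x(1) _ cont])
    fix t assume t: "0 < t" "t < x"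
    have "3 * sin (t / 2) < t / 2 * (2 + cos (t / 2))"
      using cusa_huygens [of "t / 2"] t x by auto
    moreover have "0 < t / 2 * (2 + cos (t / 2))"
      using t two_plus_cos_pos [of "t / 2"] by (intro mult_pos_pos) auto
    ultimately have "sin (t / 2) / (t / 2 * (2 + cos (t / 2))) < 1 / 3"
      by (simp only: pos_divide_less_eq)
    then have "0 < ?D' (1 / 6) t"
      by (intro mult_pos_pos [OF factor [OF t]]) auto
    then show "\<exists>y. (?D (1 / 6) has_real_derivative y) (at t) \<and> 0 < y"
      using has_real_derivative_diff_Si [of t "1 / 6"] t by blast
  qed
  then show "Si x < 1 / 6 * (x + sin x + 8 * sin (x / 2))"
    unfolding at_0 by linarith
qed

end
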